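(* Let $\lambda=(\lambda_1,\dots,\lambda_N)$ be a partition with $\lambda_1\geq\cdots\geq\lambda_N\geq 1$, let $\lambda^*$ be its extended Young diagram, and let $\{p_{i,j}(\theta)\}_{(i,j)\in\lambda^*}$ be the functions of non-zero indeterminates $\{\theta_{i,j}\}_{(i,j)\in\lambda^*}$ determined by the identities $$\det\Big(\big(p_{a+i-1,b+j-1}(\theta)\big)_{1\leq i,j\leq n_{a,b}}\Big)=\theta_{a,b}\qquad\text{for all }(a,b)\in\lambda^*.$$ Let $\{x_{i,j}\}_{(i,j)\in\lambda}$ be indeterminates and substitute $$\theta_{i,j}=1\ \text{ for }(i,j)\in\lambda^*\setminus\lambda,\qquad \theta_{a,b}=\prod_{r=0}^{n_{a,b}-1}\ \prod_{(i,j)\in\lambda_{a+r,b+r}} x_{i,j}\ \text{ for }(a,b)\in\lambda .$$ Then under this substitution, for every $(a,b)\in\lambda^*$, $p_{a,b}(\theta)$ becomes the Bessenrodt–Stanley polynomial $p_{a,b}(x)$, where $$p_{a,b}(x)=1\ \text{ if }(a,b)\in\lambda^*\setminus\lambda,\qquad p_{a,b}(x)=\sum_{\mu\subseteq\lambda_{a,b}}\ \prod_{(r,s)\in\lambda_{a,b}\setminus\mu}x_{r,s}\ \text{ if }(a,b)\in\lambda,$$ the sum running over all sub-diagrams $\mu$ of $\lambda_{a,b}$. In particular all denominators cancel and $p_{a,b}(\theta)$ becomes a polynomial in the $x_{i,j}$.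
   Context: The Young diagram of $\lambda$ is drawn with rows $1,\dots,N$ from top to bottom, left-justified; its boxes are the pairs $(i,j)$ with $1\le i\le N$, $1\le j\le\lambda_i$. The extended Young diagram $\lambda^*$ is obtained by adjoining to $\lambda$ a border strip from the end of the first row to the end of the first column: $\lambda^*_1=\lambda_1+1$ and $\lambda^*_i=\lambda_{i-1}+1$ for $i=2,\dots,N+1$. For $(a,b)\in\lambda^*$, $n_{a,b}\geq1$ is the largest $n$ such that the square $\{(i,j): a\le i\le a+n-1,\ b\le j\le b+n-1\}$ is contained in $\lambda^*$. The paper asserts that the determinant identities determine the $p_{i,j}(\theta)$ uniquely. For a box $(a,b)$, $\lambda_{a,b}=\{(i,j)\in\lambda: i\ge a,\ j\ge b\}$ (the part of $\lambda$ weakly south-east of $(a,b)$; empty if $(a,b)\notin\lambda$). A sub-diagram $\mu$ of $\lambda_{a,b}$ is a subset $\mu\subseteq\lambda_{a,b}$ (possibly empty or all of $\lambda_{a,b}$) forming a Young diagram with corner at $(a,b)$, i.e. whenever $(r,s)\in\mu$, every $(r',s')$ with $a\le r'\le r$, $b\le s'\le s$ lies in $\mu$. *)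

theory Defs
  imports
    "HOL-Library.Poly_Mapping"
    "HOL-Library.Product_Lexorder"
    "HOL-Computational_Algebra.Fraction_Field"
    "Jordan_Normal_Form.Determinant"
begin

section \<open>Polynomials in several variables and their specialization\<close>

text \<open>
  Finitely supported functions from exponent vectors to coefficients. If the variables are
  linearly ordered, the library makes this an integral domain; the order on the variables (for
  boxes, the lexicographic order of \<open>HOL-Library.Product_Lexorder\<close>) serves no other purpose.
\<close>

type_synonym ('v, 'k) mpoly = "('v \<Rightarrow>\<^sub>0 nat) \<Rightarrow>\<^sub>0 'k"

definition mvar :: "'v \<Rightarrow> ('v, 'k::comm_semiring_1) mpoly" where
  "mvar v = Poly_Mapping.single (Poly_Mapping.single v 1) 1"

definition mpoly_subst ::
  "('v \<Rightarrow> ('w, 'k) mpoly) \<Rightarrow> ('v, 'k) mpoly \<Rightarrow> ('w, 'k::comm_ring_1) mpoly" where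
  "mpoly_subst \<sigma> f = (\<Sum>m\<in>Poly_Mapping.keys f.
     Poly_Mapping.single 0 (Poly_Mapping.lookup f m) *
     (\<Prod>v\<in>Poly_Mapping.keys m. \<sigma> v ^ Poly_Mapping.lookup m v))"

lemma prod_keys_extend:
  fixes \<sigma> :: "'v \<Rightarrow> 'a::comm_monoid_mult"
  assumes "finite A" "Poly_Mapping.keys m \<subseteq> A"
  shows "(\<Prod>v\<in>Poly_Mapping.keys m. \<sigma> v ^ Poly_Mapping.lookup m v)
       = (\<Prod>v\<in>A. \<sigma> v ^ Poly_Mapping.lookup m v)"
  using assms by (intro prod.mono_neutral_left) (auto simp: in_keys_iff)

lemma prod_keys_add:
  fixes \<sigma> :: "'v \<Rightarrow> 'a::comm_monoid_mult" and m n :: "'v \<Rightarrow>\<^sub>0 nat"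
  shows "(\<Prod>v\<in>Poly_Mapping.keys (m + n). \<sigma> v ^ Poly_Mapping.lookup (m + n) v)
       = (\<Prod>v\<in>Poly_Mapping.keys m. \<sigma> v ^ Poly_Mapping.lookup m v)
       * (\<Prod>v\<in>Poly_Mapping.keys n. \<sigma> v ^ Poly_Mapping.lookup n v)"
proof -
  define A where "A = Poly_Mapping.keys m \<union> Poly_Mapping.keys n"
  have A: "finite A" "Poly_Mapping.keys (m + n) \<subseteq> A" "Poly_Mapping.keys m \<subseteq> A"
    "Poly_Mapping.keys n \<subseteq> A"
    using keys_add[of m n] by (auto simp: A_def)
  show ?thesis
    unfolding prod_keys_extend[OF A(1,2)] prod_keys_extend[OF A(1,3)] prod_keys_extend[OF A(1,4)]
    by (simp add: lookup_add power_add prod.distrib)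
qed

lemma mpoly_subst_zero [simp]: "mpoly_subst \<sigma> 0 = 0"
  by (simp add: mpoly_subst_def)

lemma mpoly_subst_single:
  "mpoly_subst \<sigma> (Poly_Mapping.single m c) = Poly_Mapping.single 0 c *
     (\<Prod>v\<in>Poly_Mapping.keys m. \<sigma> v ^ Poly_Mapping.lookup m v)"
  by (simp add: mpoly_subst_def)

lemma mpoly_subst_one [simp]: "mpoly_subst \<sigma> 1 = 1"
  by (simp add: mpoly_subst_def)

lemma mpoly_subst_mvar [simp]: "mpoly_subst \<sigma> (mvar v) = \<sigma> v"
  by (simp add: mvar_def mpoly_subst_single)

lemma mpoly_subst_add: "mpoly_subst \<sigma> (f + g) = mpoly_subst \<sigma> f + mpoly_subst \<sigma> g"
  unfolding mpoly_subst_def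
  by (rule setsum_keys_plus_distrib) (simp_all add: single_add distrib_right)

lemma mpoly_subst_sum: "mpoly_subst \<sigma> (\<Sum>i\<in>I. f i) = (\<Sum>i\<in>I. mpoly_subst \<sigma> (f i))"
  by (induction I rule: infinite_finite_induct) (simp_all add: mpoly_subst_add)

lemma mpoly_eq_sum_single:
  "f = (\<Sum>m\<in>Poly_Mapping.keys f. Poly_Mapping.single m (Poly_Mapping.lookup f m))"
  by (rule poly_mapping_eqI)
    (auto simp: lookup_sum lookup_single when_def in_keys_iff)

lemma single_zero_mult:
  "(Poly_Mapping.single 0 (c * d) :: ('v, 'k::comm_ring_1) mpoly)
     = Poly_Mapping.single 0 c * Poly_Mapping.single 0 d"
  by (simp add: mult_single)

lemma mpoly_subst_mult: "mpoly_subst \<sigma> (f * g) = mpoly_subst \<sigma> f * mpoly_subst \<sigma> g"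
proof -
  have single: "mpoly_subst \<sigma> (Poly_Mapping.single m c * Poly_Mapping.single n d)
      = mpoly_subst \<sigma> (Poly_Mapping.single m c) * mpoly_subst \<sigma> (Poly_Mapping.single n d)"
    for m n c d
    unfolding mult_single
    unfolding mpoly_subst_single prod_keys_add single_zero_mult by (simp only: mult_ac)
  define F where "F m = Poly_Mapping.single m (Poly_Mapping.lookup f m)" for m
  define G where "G m = Poly_Mapping.single m (Poly_Mapping.lookup g m)" for m
  have f: "f = (\<Sum>m\<in>Poly_Mapping.keys f. F m)" and g: "g = (\<Sum>m\<in>Poly_Mapping.keys g. G m)"
    unfolding F_def G_def by (rule mpoly_eq_sum_single)+
  have "mpoly_subst \<sigma> ((\<Sum>m\<in>A. F m) * (\<Sum>n\<in>B. G n))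
      = mpoly_subst \<sigma> (\<Sum>m\<in>A. F m) * mpoly_subst \<sigma> (\<Sum>n\<in>B. G n)" for A B
    by (simp add: sum_product mpoly_subst_sum F_def G_def single)
  then show ?thesis using f g by metis
qed

text \<open>
  The rational function \<open>f\<close> is defined at the substitution \<open>\<sigma>\<close> and becomes \<open>g\<close> there: some
  representation of \<open>f\<close> as a fraction has a denominator that does not vanish under \<open>\<sigma>\<close>. The value
  \<open>g\<close> does not depend on the representation, see \<open>specializes_to_unique\<close>.
\<close>

definition specializes_to ::
  "('v \<Rightarrow> ('w, 'k) mpoly) \<Rightarrow> ('v::linorder, 'k) mpoly fract \<Rightarrow>
     ('w::linorder, 'k::idom) mpoly fract \<Rightarrow> bool" where
  "specializes_to \<sigma> f g \<longleftrightarrow> (\<exists>P Q. f = Fract P Q \<and> mpoly_subst \<sigma> Q \<noteq> 0 \<and>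
     g = Fract (mpoly_subst \<sigma> P) (mpoly_subst \<sigma> Q))"

lemma specializes_to_unique:
  assumes "specializes_to \<sigma> f g" and "specializes_to \<sigma> f h"
  shows "g = h"
proof -
  from assms(1) obtain P Q where 1: "f = Fract P Q" "mpoly_subst \<sigma> Q \<noteq> 0"
    "g = Fract (mpoly_subst \<sigma> P) (mpoly_subst \<sigma> Q)"
    by (auto simp: specializes_to_def)
  from assms(2) obtain R S where 2: "f = Fract R S" "mpoly_subst \<sigma> S \<noteq> 0"
    "h = Fract (mpoly_subst \<sigma> R) (mpoly_subst \<sigma> S)"
    by (auto simp: specializes_to_def)
  from 1 2 have "Q \<noteq> 0" "S \<noteq> 0" by auto
  with 1 2 have "P * S = R * Q" by (simp add: eq_fract)
  then have "mpoly_subst \<sigma> P * mpoly_subst \<sigma> S = mpoly_subst \<sigma> R * mpoly_subst \<sigma> Q"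
    by (metis mpoly_subst_mult)
  with 1 2 show ?thesis by (simp add: eq_fract)
qed


section \<open>Diagrams\<close>

type_synonym box = "nat \<times> nat"

text \<open>
  A partition is the list of its parts; boxes are numbered from 1, list positions from 0.
\<close>

definition is_partition :: "nat list \<Rightarrow> bool" where
  "is_partition lam \<longleftrightarrow> sorted_wrt (\<ge>) lam \<and> (\<forall>k\<in>set lam. 1 \<le> k)"

definition young_diagram :: "nat list \<Rightarrow> box set" where
  "young_diagram lam = {(i, j). 1 \<le> i \<and> i \<le> length lam \<and> 1 \<le> j \<and> j \<le> lam ! (i - 1)}"

definition ext_partition :: "nat list \<Rightarrow> nat list" where
  "ext_partition lam = (hd lam + 1) # map (\<lambda>k. k + 1) lam"

abbreviation ext_diagram :: "nat list \<Rightarrow> box set" where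
  "ext_diagram lam \<equiv> young_diagram (ext_partition lam)"

definition square_size :: "nat list \<Rightarrow> box \<Rightarrow> nat" where
  "square_size lam = (\<lambda>(a, b). GREATEST n. {a..<a + n} \<times> {b..<b + n} \<subseteq> ext_diagram lam)"

definition se_part :: "nat list \<Rightarrow> box \<Rightarrow> box set" where
  "se_part lam = (\<lambda>(a, b). {(i, j) \<in> young_diagram lam. a \<le> i \<and> b \<le> j})"

definition sub_diagrams :: "nat list \<Rightarrow> box \<Rightarrow> box set set" where
  "sub_diagrams lam = (\<lambda>(a, b). {\<mu>. \<mu> \<subseteq> se_part lam (a, b) \<and>
     (\<forall>(r, s)\<in>\<mu>. \<forall>r' s'. a \<le> r' \<and> r' \<le> r \<and> b \<le> s' \<and> s' \<le> s \<longrightarrow> (r', s') \<in> \<mu>)})"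


section \<open>The functions defined by the determinant identities\<close>

text \<open>
  The ambient field is the field of fractions in one indeterminate for every pair of natural
  numbers; only the indeterminates at boxes of the extended diagram are used.
\<close>

definition det_identities ::
  "nat list \<Rightarrow> (box \<Rightarrow> (box, 'k::idom) mpoly fract) \<Rightarrow> bool" where
  "det_identities lam p \<longleftrightarrow> (\<forall>(a, b)\<in>ext_diagram lam.
     det (mat (square_size lam (a, b)) (square_size lam (a, b)) (\<lambda>(i, j). p (a + i, b + j)))
       = Fract (mvar (a, b)) 1)"

text \<open>
  Outside the extended diagram, where the identities say nothing, the value is fixed to be 0. That
  the description is proper is shown in \<open>theta_fun_ex1\<close> and \<open>theta_fun_unique\<close> below.
\<close>

definition theta_fun :: "nat list \<Rightarrow> box \<Rightarrow> (box, 'k::idom) mpoly fract" where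
  "theta_fun lam = (THE p. det_identities lam p \<and> (\<forall>c. c \<notin> ext_diagram lam \<longrightarrow> p c = 0))"

definition theta_value :: "nat list \<Rightarrow> box \<Rightarrow> (box, 'k::idom) mpoly" where
  "theta_value lam = (\<lambda>(a, b). if (a, b) \<in> young_diagram lam
     then \<Prod>r<square_size lam (a, b). \<Prod>c\<in>se_part lam (a + r, b + r). mvar c
     else 1)"

definition bs_poly :: "nat list \<Rightarrow> box \<Rightarrow> (box, 'k::idom) mpoly" where
  "bs_poly lam c = (if c \<in> young_diagram lam
     then \<Sum>\<mu>\<in>sub_diagrams lam c. \<Prod>d\<in>se_part lam c - \<mu>. mvar d
     else 1)"


section \<open>Existence and uniqueness of the functions\<close>

lemma ext_diagram_down:
  assumes lam: "is_partition lam" "lam \<noteq> []" and ij: "(i, j) \<in> ext_diagram lam"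
    and le: "1 \<le> i'" "i' \<le> i" "1 \<le> j'" "j' \<le> j"
  shows "(i', j') \<in> ext_diagram lam"
proof -
  have "sorted_wrt (\<ge>) (ext_partition lam)"
    using lam by (cases lam) (auto simp: is_partition_def ext_partition_def sorted_wrt_map)
  moreover from ij le have "i' - 1 < i - 1 \<or> i' = i" "i - 1 < length (ext_partition lam)"
    by (auto simp: young_diagram_def)
  ultimately have "ext_partition lam ! (i - 1) \<le> ext_partition lam ! (i' - 1)"
    by (auto simp: sorted_wrt_iff_nth_less)
  with ij le show ?thesis by (auto simp: young_diagram_def)
qed

lemma finite_young_diagram [simp]: "finite (young_diagram lam)"
proof (rule finite_subset)
  show "young_diagram lam \<subseteq> {..length lam} \<times> {..Max (set lam)}"
    by (auto simp: young_diagram_def intro!: order.trans[OF _ Max_ge] nth_mem)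
qed simp

lemma square_bound:
  assumes "{a..<a + n} \<times> {b..<b + n} \<subseteq> ext_diagram lam"
  shows "n \<le> Suc (length lam)"
proof (cases n)
  case (Suc m)
  then have "(a + m, b) \<in> {a..<a + n} \<times> {b..<b + n}" by simp
  with assms have "(a + m, b) \<in> ext_diagram lam" by blast
  moreover have "(a, b) \<in> {a..<a + n} \<times> {b..<b + n}" using Suc by simp
  with assms have "(a, b) \<in> ext_diagram lam" by blast
  ultimately show ?thesis using Suc by (auto simp: young_diagram_def ext_partition_def)
qed simp

lemma square_size_subset:
  "{a..<a + square_size lam (a, b)} \<times> {b..<b + square_size lam (a, b)} \<subseteq> ext_diagram lam"
  unfolding square_size_def prod.case
  by (rule GreatestI_nat[of "\<lambda>n. {a..<a + n} \<times> {b..<b + n} \<subseteq> ext_diagram lam" 0])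
    (use square_bound in auto)

lemma square_size_ge:
  assumes "{a..<a + n} \<times> {b..<b + n} \<subseteq> ext_diagram lam"
  shows "n \<le> square_size lam (a, b)"
  unfolding square_size_def prod.case
  by (rule Greatest_le_nat[of "\<lambda>n. {a..<a + n} \<times> {b..<b + n} \<subseteq> ext_diagram lam"])
    (use square_bound assms in auto)

lemma square_size_Suc:
  assumes lam: "is_partition lam" "lam \<noteq> []" and ab: "(a, b) \<in> ext_diagram lam"
  obtains n where "square_size lam (a, b) = Suc n"
    "n = 0 \<or> (a + 1, b + 1) \<in> ext_diagram lam \<and> square_size lam (a + 1, b + 1) = n"
proof -
  have pos: "1 \<le> a" "1 \<le> b" using ab by (auto simp: young_diagram_def)
  have "{a..<a + 1} \<times> {b..<b + 1} \<subseteq> ext_diagram lam" using ab by simp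
  then have "1 \<le> square_size lam (a, b)" by (rule square_size_ge)
  then obtain n where n: "square_size lam (a, b) = Suc n" by (cases "square_size lam (a, b)") auto
  have sub: "{a..<a + Suc n} \<times> {b..<b + Suc n} \<subseteq> ext_diagram lam"
    using square_size_subset[of a lam b] n by simp
  have "(a + 1, b + 1) \<in> ext_diagram lam \<and> square_size lam (a + 1, b + 1) = n" if "n \<noteq> 0"
  proof
    have "(a + 1, b + 1) \<in> {a..<a + Suc n} \<times> {b..<b + Suc n}" using that by simp
    with sub show "(a + 1, b + 1) \<in> ext_diagram lam" by blast
    show "square_size lam (a + 1, b + 1) = n"
    proof (rule antisym)
      have "{a + 1..<a + 1 + n} \<times> {b + 1..<b + 1 + n} \<subseteq> {a..<a + Suc n} \<times> {b..<b + Suc n}"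
        by auto
      with sub show "n \<le> square_size lam (a + 1, b + 1)" by (intro square_size_ge) blast
    next
      define m where "m = square_size lam (a + 1, b + 1)"
      show "square_size lam (a + 1, b + 1) \<le> n"
      proof (cases "m = 0")
        case False
        have "(a + m, b + m) \<in> {a + 1..<a + 1 + m} \<times> {b + 1..<b + 1 + m}" using False by simp
        then have "(a + m, b + m) \<in> ext_diagram lam"
          using square_size_subset[of "a + 1" lam "b + 1"] unfolding m_def by blast
        then have "{a..<a + Suc m} \<times> {b..<b + Suc m} \<subseteq> ext_diagram lam"
          using pos by (auto intro: ext_diagram_down[OF lam])
        then have "Suc m \<le> square_size lam (a, b)" by (rule square_size_ge)
        with n show ?thesis by (simp add: m_def)
      qed (simp add: m_def)
    qed
  qed
  with n show thesis by (intro that) auto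
qed

lemma det_corner:
  fixes p :: "nat \<times> nat \<Rightarrow> 'a::comm_ring_1"
  obtains r where "\<And>q. (\<And>i j. a + b < i + j \<Longrightarrow> q (i, j) = p (i, j)) \<Longrightarrow>
    det (mat (Suc n) (Suc n) (\<lambda>(i, j). q (a + i, b + j)))
      = q (a, b) * det (mat n n (\<lambda>(i, j). p (a + 1 + i, b + 1 + j))) + r"
proof -
  define A where "A q = mat (Suc n) (Suc n) (\<lambda>(i, j). q (a + i, b + j))"
    for q :: "nat \<times> nat \<Rightarrow> 'a"
  define r where "r = (\<Sum>j\<in>{1..<Suc n}. p (a, b + j) * cofactor (A p) 0 j)"
  have "det (A q) = q (a, b) * det (mat n n (\<lambda>(i, j). p (a + 1 + i, b + 1 + j))) + r"
    if q: "\<And>i j. a + b < i + j \<Longrightarrow> q (i, j) = p (i, j)" for q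
  proof -
    have cof: "cofactor (A q) 0 j = cofactor (A p) 0 j" for j
    proof -
      have "mat_delete (A q) 0 j = mat_delete (A p) 0 j"
        by (rule eq_matI) (auto simp: mat_delete_def A_def q)
      then show ?thesis by (simp add: cofactor_def)
    qed
    have "mat_delete (A p) 0 0 = mat n n (\<lambda>(i, j). p (a + 1 + i, b + 1 + j))"
      by (rule eq_matI) (auto simp: mat_delete_def A_def)
    then have cof0: "cofactor (A p) 0 0 = det (mat n n (\<lambda>(i, j). p (a + 1 + i, b + 1 + j)))"
      by (simp add: cofactor_def)
    have "det (A q) = (\<Sum>j<Suc n. A q $$ (0, j) * cofactor (A q) 0 j)"
      by (rule laplace_expansion_row) (auto simp: A_def)
    also have "\<dots> = (\<Sum>j<Suc n. q (a, b + j) * cofactor (A p) 0 j)"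
      by (rule sum.cong) (auto simp: cof, auto simp: A_def)
    also have "\<dots> = q (a, b) * cofactor (A p) 0 0
        + (\<Sum>j\<in>{1..<Suc n}. q (a, b + j) * cofactor (A p) 0 j)"
      by (simp add: lessThan_atLeast0 sum.atLeast_Suc_lessThan del: sum.op_ivl_Suc)
    also have "(\<Sum>j\<in>{1..<Suc n}. q (a, b + j) * cofactor (A p) 0 j) = r"
      unfolding r_def by (rule sum.cong) (auto simp: q)
    finally show ?thesis by (simp add: cof0)
  qed
  then show thesis using that[of r] by (simp add: A_def)
qed

lemma mvar_nonzero: "(mvar v :: ('v, 'k::comm_ring_1) mpoly) \<noteq> 0"
proof
  assume "(mvar v :: ('v, 'k) mpoly) = 0"
  then have "Poly_Mapping.lookup (mvar v :: ('v, 'k) mpoly) (Poly_Mapping.single v 1) = 0" by simp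
  then show False by (simp add: mvar_def)
qed

definition det_identity_at ::
  "nat list \<Rightarrow> (box \<Rightarrow> (box, 'k::idom) mpoly fract) \<Rightarrow> nat \<Rightarrow> nat \<Rightarrow> bool" where
  "det_identity_at lam p a b \<longleftrightarrow>
     det (mat (square_size lam (a, b)) (square_size lam (a, b)) (\<lambda>(i, j). p (a + i, b + j)))
       = Fract (mvar (a, b)) 1"

lemma det_identities_iff:
  "det_identities lam p \<longleftrightarrow> (\<forall>a b. (a, b) \<in> ext_diagram lam \<longrightarrow> det_identity_at lam p a b)"
  by (auto simp: det_identities_def det_identity_at_def)

lemma det_identity_at_cong:
  assumes "\<And>i j. a \<le> i \<Longrightarrow> b \<le> j \<Longrightarrow> (i, j) \<in> ext_diagram lam \<Longrightarrow> q (i, j) = p (i, j)"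
  shows "det_identity_at lam q a b \<longleftrightarrow> det_identity_at lam p a b"
proof -
  let ?n = "square_size lam (a, b)"
  have "mat ?n ?n (\<lambda>(i, j). q (a + i, b + j)) = mat ?n ?n (\<lambda>(i, j). p (a + i, b + j))"
  proof (rule eq_matI)
    fix i j assume "i < dim_row (mat ?n ?n (\<lambda>(i, j). p (a + i, b + j)))"
      "j < dim_col (mat ?n ?n (\<lambda>(i, j). p (a + i, b + j)))"
    then have ij: "i < ?n" "j < ?n" by simp_all
    then have "(a + i, b + j) \<in> {a..<a + ?n} \<times> {b..<b + ?n}" by simp
    then have "(a + i, b + j) \<in> ext_diagram lam" using square_size_subset by blast
    with ij assms show "mat ?n ?n (\<lambda>(i, j). q (a + i, b + j)) $$ (i, j)
        = mat ?n ?n (\<lambda>(i, j). p (a + i, b + j)) $$ (i, j)" by simp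
  qed simp_all
  then show ?thesis by (simp add: det_identity_at_def)
qed

lemma det_identity_at_linear:
  assumes lam: "is_partition lam" "lam \<noteq> []" and ab: "(a, b) \<in> ext_diagram lam"
    and p: "\<And>i j. (i, j) \<in> ext_diagram lam \<Longrightarrow> a + b < i + j \<Longrightarrow> det_identity_at lam p i j"
  obtains c where "\<And>q. (\<And>i j. a + b < i + j \<Longrightarrow> q (i, j) = p (i, j)) \<Longrightarrow>
    det_identity_at lam q a b \<longleftrightarrow> q (a, b) = c"
proof -
  obtain n where n: "square_size lam (a, b) = Suc n"
    "n = 0 \<or> (a + 1, b + 1) \<in> ext_diagram lam \<and> square_size lam (a + 1, b + 1) = n"
    using square_size_Suc[OF lam ab] .
  define d where "d = det (mat n n (\<lambda>(i, j). p (a + 1 + i, b + 1 + j)))"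
  have "d \<noteq> 0"
  proof (cases "n = 0")
    case False
    with n have "(a + 1, b + 1) \<in> ext_diagram lam" "square_size lam (a + 1, b + 1) = n" by auto
    with p[of "a + 1" "b + 1"] have "d = Fract (mvar (a + 1, b + 1)) 1"
      by (simp add: det_identity_at_def d_def)
    then show ?thesis by (simp add: Zero_fract_def eq_fract mvar_nonzero)
  qed (simp add: d_def)
  obtain r where r: "\<And>q. (\<And>i j. a + b < i + j \<Longrightarrow> q (i, j) = p (i, j)) \<Longrightarrow>
    det (mat (Suc n) (Suc n) (\<lambda>(i, j). q (a + i, b + j))) = q (a, b) * d + r"
    using det_corner[where a = a and b = b and p = p and n = n] unfolding d_def by blast
  show thesis
  proof (rule that)
    fix q :: "box \<Rightarrow> (box, 'a) mpoly fract"
    assume "\<And>i j. a + b < i + j \<Longrightarrow> q (i, j) = p (i, j)"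
    from r[OF this] show "det_identity_at lam q a b \<longleftrightarrow> q (a, b) = (Fract (mvar (a, b)) 1 - r) / d"
      using \<open>d \<noteq> 0\<close> by (auto simp: det_identity_at_def n(1) field_simps)
  qed
qed

lemma theta_fun_ex1:
  assumes lam: "is_partition lam" "lam \<noteq> []"
  shows "\<exists>!p :: box \<Rightarrow> (box, 'k::idom) mpoly fract.
    det_identities lam p \<and> (\<forall>c. c \<notin> ext_diagram lam \<longrightarrow> p c = 0)"
proof -
  let ?E = "ext_diagram lam"
  obtain M where M: "\<And>i j. (i, j) \<in> ?E \<Longrightarrow> i + j < M"
  proof -
    have "finite ((\<lambda>(i, j). i + j) ` ?E)" by simp
    then obtain M where "\<forall>s\<in>(\<lambda>(i, j). i + j) ` ?E. s < M"
      using finite_nat_set_iff_bounded by blast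
    then show thesis by (intro that[of M]) force
  qed
  have "\<exists>p :: box \<Rightarrow> (box, 'k) mpoly fract.
      (\<forall>a b. (a, b) \<in> ?E \<and> M \<le> a + b + k \<longrightarrow> det_identity_at lam p a b)
      \<and> (\<forall>c. c \<notin> ?E \<longrightarrow> p c = 0)" for k
  proof (induction k)
    case 0
    show ?case by (rule exI[of _ "\<lambda>_. 0"]) (use M in force)
  next
    case (Suc k)
    then obtain p :: "box \<Rightarrow> (box, 'k) mpoly fract" where
      p: "\<And>a b. (a, b) \<in> ?E \<Longrightarrow> M \<le> a + b + k \<Longrightarrow> det_identity_at lam p a b"
      and p0: "\<And>c. c \<notin> ?E \<Longrightarrow> p c = 0" by blast
    have "\<exists>c. \<forall>q. (\<forall>i j. a + b < i + j \<longrightarrow> q (i, j) = p (i, j)) \<longrightarrow>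
        (det_identity_at lam q a b \<longleftrightarrow> q (a, b) = c)"
      if ab: "(a, b) \<in> ?E" "a + b + Suc k = M" for a b
    proof -
      have "\<And>i j. (i, j) \<in> ?E \<Longrightarrow> a + b < i + j \<Longrightarrow> det_identity_at lam p i j"
        using ab by (intro p) auto
      from det_identity_at_linear[OF lam ab(1) this] show ?thesis by metis
    qed
    then obtain c where c: "\<And>a b q. (a, b) \<in> ?E \<Longrightarrow> a + b + Suc k = M \<Longrightarrow>
        (\<And>i j. a + b < i + j \<Longrightarrow> q (i, j) = p (i, j)) \<Longrightarrow>
        (det_identity_at lam q a b \<longleftrightarrow> q (a, b) = c a b)"
      by metis
    define q where "q = (\<lambda>(a, b). if (a, b) \<in> ?E \<and> a + b + Suc k = M then c a b else p (a, b))"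
    have "det_identity_at lam q a b" if ab: "(a, b) \<in> ?E" "M \<le> a + b + Suc k" for a b
    proof (cases "a + b + Suc k = M")
      case True
      have "\<And>i j. a + b < i + j \<Longrightarrow> q (i, j) = p (i, j)" using True by (auto simp: q_def)
      from c[OF ab(1) True this] show ?thesis using ab True by (simp add: q_def)
    next
      case False
      then have "det_identity_at lam q a b \<longleftrightarrow> det_identity_at lam p a b"
        using ab by (intro det_identity_at_cong) (auto simp: q_def)
      with p[of a b] ab False show ?thesis by simp
    qed
    moreover have "\<forall>d. d \<notin> ?E \<longrightarrow> q d = 0" by (auto simp: q_def p0)
    ultimately show ?case by blast
  qed
  from this[of M] have ex: "\<exists>p :: box \<Rightarrow> (box, 'k) mpoly fract.
      det_identities lam p \<and> (\<forall>c. c \<notin> ?E \<longrightarrow> p c = 0)"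
    by (simp add: det_identities_iff)
  have "p = q" if p: "det_identities lam p" "\<forall>c. c \<notin> ?E \<longrightarrow> p c = 0"
    and q: "det_identities lam q" "\<forall>c. c \<notin> ?E \<longrightarrow> q c = 0"
    for p q :: "box \<Rightarrow> (box, 'k) mpoly fract"
  proof -
    have "p (a, b) = q (a, b)" for a b
    proof (induction "M - (a + b)" arbitrary: a b rule: less_induct)
      case less
      show ?case
      proof (cases "(a, b) \<in> ?E")
        case True
        then have "a + b < M" by (rule M)
        then have "\<And>i j. a + b < i + j \<Longrightarrow> q (i, j) = p (i, j)"
          using less.hyps by (metis diff_less_mono2)
        then have qp: "det_identity_at lam q a b \<longleftrightarrow> q (a, b) = c"
          "det_identity_at lam p a b \<longleftrightarrow> p (a, b) = c"
          if "\<And>q. (\<And>i j. a + b < i + j \<Longrightarrow> q (i, j) = p (i, j)) \<Longrightarrow>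
            det_identity_at lam q a b \<longleftrightarrow> q (a, b) = c" for c
          using that by blast+
        obtain c where c: "\<And>q. (\<And>i j. a + b < i + j \<Longrightarrow> q (i, j) = p (i, j)) \<Longrightarrow>
            det_identity_at lam q a b \<longleftrightarrow> q (a, b) = c"
          using det_identity_at_linear[OF lam True, of p] p by (auto simp: det_identities_iff)
        have "det_identity_at lam p a b" "det_identity_at lam q a b"
          using p q True by (auto simp: det_identities_iff)
        with qp[OF c] show ?thesis by simp
      qed (use p q in simp)
    qed
    then show ?thesis by auto
  qed
  with ex show ?thesis by blast
qed

lemma theta_fun_det_identities:
  assumes "is_partition lam" "lam \<noteq> []"
  shows "det_identities lam (theta_fun lam)"
  using theI'[OF theta_fun_ex1[OF assms]] unfolding theta_fun_def by blast

lemma theta_fun_unique: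
  assumes lam: "is_partition lam" "lam \<noteq> []" and p: "det_identities lam p"
    and c: "c \<in> ext_diagram lam"
  shows "p c = theta_fun lam c"
proof -
  define q where "q c = (if c \<in> ext_diagram lam then p c else 0)" for c
  have "det_identity_at lam q a b \<longleftrightarrow> det_identity_at lam p a b" for a b
    by (rule det_identity_at_cong) (simp add: q_def)
  then have "det_identities lam q" using p by (simp add: det_identities_iff)
  moreover have "\<forall>c. c \<notin> ext_diagram lam \<longrightarrow> q c = 0" by (simp add: q_def)
  ultimately have "theta_fun lam = q"
    unfolding theta_fun_def by (intro the1_equality[OF theta_fun_ex1[OF lam]]) blast
  with c show ?thesis by (simp add: q_def)
qed

end

(*
  A sub-diagram of the part of lam south-east of (a + i, b + j) is given by its boundary path, which
  meets the diagonal through (a, b) exactly once, at the north-west corner of some box (a + k, b + k)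
  with max i j <= k < n, where n is the square size at (a, b). Cutting the path there factors the
  n x n matrix of the Bessenrodt-Stanley polynomials as (upper unitriangular) * (diagonal) * (lower
  unitriangular), with k-th diagonal entry the product of the x over the part of lam south-east of
  (a + k, b + k). Hence the determinant is theta_(a,b). The determinant identities are linear in
  their top left entry, whose coefficient is the theta of the next diagonal box (or 1) and does
  not vanish under the substitution; so the entries specialize as claimed, by descent on a + b.
*)
theory Submission
  imports Defs
begin

section \<open>Ideals of sets of boxes, cut at a lattice point\<close>

section \<open>Order ideals\<close>

text \<open>Closedness is relative to \<open>S\<close>, unlike in \<open>sub_diagrams\<close>, so
  that the same notion applies to the pieces of a diagram left after a cut, which need not have a
  corner box.\<close>

definition ideals :: "box set \<Rightarrow> box set set" where
  "ideals S = {\<mu>. \<mu> \<subseteq> S \<and> (\<forall>(r, s)\<in>\<mu>. \<forall>(r', s')\<in>S. r' \<le> r \<longrightarrow> s' \<le> s \<longrightarrow> (r', s') \<in> \<mu>)}"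

definition ideal_sum :: "(box \<Rightarrow> 'a::comm_ring_1) \<Rightarrow> box set \<Rightarrow> 'a" where
  "ideal_sum w S = (\<Sum>\<mu>\<in>ideals S. \<Prod>c\<in>S - \<mu>. w c)"

text \<open>The quadrants at the north-west corner of the box \<open>(r, s)\<close>. They partition
  the plane, and the box itself belongs to \<open>SE r s\<close>.\<close>

definition NW :: "nat \<Rightarrow> nat \<Rightarrow> box set" where "NW r s = {..<r} \<times> {..<s}"
definition NE :: "nat \<Rightarrow> nat \<Rightarrow> box set" where "NE r s = {..<r} \<times> {s..}"
definition SW :: "nat \<Rightarrow> nat \<Rightarrow> box set" where "SW r s = {r..} \<times> {..<s}"
definition SE :: "nat \<Rightarrow> nat \<Rightarrow> box set" where "SE r s = {r..} \<times> {s..}"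

lemmas quadrant_defs = NW_def NE_def SW_def SE_def

lemma idealsD:
  assumes "\<mu> \<in> ideals S" "(r, s) \<in> \<mu>" "(r', s') \<in> S" "r' \<le> r" "s' \<le> s"
  shows "(r', s') \<in> \<mu>"
  using assms unfolding ideals_def by blast

lemma ideals_subset: "\<mu> \<in> ideals S \<Longrightarrow> \<mu> \<subseteq> S"
  by (simp add: ideals_def)

lemma idealsI:
  assumes "\<mu> \<subseteq> S"
    and "\<And>r s r' s'. (r, s) \<in> \<mu> \<Longrightarrow> (r', s') \<in> S \<Longrightarrow> r' \<le> r \<Longrightarrow> s' \<le> s \<Longrightarrow> (r', s') \<in> \<mu>"
  shows "\<mu> \<in> ideals S"
  using assms unfolding ideals_def by blast

lemma finite_ideals: "finite S \<Longrightarrow> finite (ideals S)"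
  by (rule finite_subset[of _ "Pow S"]) (auto simp: ideals_def)

lemma ideal_sum_empty [simp]: "ideal_sum w {} = 1"
proof -
  have "ideals {} = {{}}" by (auto simp: ideals_def)
  then show ?thesis by (simp add: ideal_sum_def)
qed

text \<open>
  The ideals of \<open>S\<close> whose boundary path passes through the north-west corner of the box \<open>(r, s)\<close>.
\<close>

definition ideals_through :: "box set \<Rightarrow> nat \<Rightarrow> nat \<Rightarrow> box set set" where
  "ideals_through S r s = {\<mu> \<in> ideals S. S \<inter> NW r s \<subseteq> \<mu> \<and> \<mu> \<inter> SE r s = {}}"

text \<open>Going north-west from \<open>NE r s\<close> never leads into \<open>SW r s\<close>, nor
  conversely. Closedness can therefore be checked on each side separately, and \<alpha> and \<beta>
  are chosen independently.\<close>

lemma ideals_through_Un: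
  assumes "\<alpha> \<in> ideals (S \<inter> NE r s)" "\<beta> \<in> ideals (S \<inter> SW r s)"
  shows "S \<inter> NW r s \<union> \<alpha> \<union> \<beta> \<in> ideals_through S r s"
proof -
  let ?\<mu> = "S \<inter> NW r s \<union> \<alpha> \<union> \<beta>"
  have sub: "\<alpha> \<subseteq> S \<inter> NE r s" "\<beta> \<subseteq> S \<inter> SW r s" using assms ideals_subset by blast+
  have "?\<mu> \<in> ideals S"
  proof (rule idealsI)
    fix i j i' j' assume *: "(i, j) \<in> ?\<mu>" "(i', j') \<in> S" "i' \<le> i" "j' \<le> j"
    from *(1) consider "(i, j) \<in> NW r s" | "(i, j) \<in> \<alpha>" | "(i, j) \<in> \<beta>" by blast
    then show "(i', j') \<in> ?\<mu>"
    proof cases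
      case 1
      with * show ?thesis by (simp add: NW_def)
    next
      case 2
      then have "i < r" using sub(1) by (auto simp: NE_def)
      then have "(i', j') \<in> NW r s \<or> (i', j') \<in> NE r s" using * by (auto simp: quadrant_defs)
      then show ?thesis using * idealsD[OF assms(1) 2, of i' j'] by blast
    next
      case 3
      then have "j < s" using sub(2) by (auto simp: SW_def)
      then have "(i', j') \<in> NW r s \<or> (i', j') \<in> SW r s" using * by (auto simp: quadrant_defs)
      then show ?thesis using * idealsD[OF assms(2) 3, of i' j'] by blast
    qed
  qed (use sub in blast)
  then show ?thesis using sub by (auto simp: ideals_through_def quadrant_defs)
qed

lemma ideals_Int:
  assumes "\<mu> \<in> ideals S"
  shows "\<mu> \<inter> T \<in> ideals (S \<inter> T)"
proof (rule idealsI)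
  fix r s r' s' assume "(r, s) \<in> \<mu> \<inter> T" "(r', s') \<in> S \<inter> T" "r' \<le> r" "s' \<le> s"
  then show "(r', s') \<in> \<mu> \<inter> T" using idealsD[OF assms, of r s r' s'] by blast
qed (use ideals_subset[OF assms] in blast)

text \<open>Such an ideal is full in \<open>NW r s\<close> and empty in \<open>SE r s\<close>, so it
  amounts to a free choice of its two other parts. The sum factors accordingly.\<close>

lemma sum_ideals_through:
  fixes w :: "box \<Rightarrow> 'a::comm_ring_1"
  assumes fin: "finite S"
  shows "(\<Sum>\<mu>\<in>ideals_through S r s. \<Prod>c\<in>S - \<mu>. w c)
    = ideal_sum w (S \<inter> NE r s) * (\<Prod>c\<in>S \<inter> SE r s. w c) * ideal_sum w (S \<inter> SW r s)"
proof -
  let ?A = "S \<inter> NE r s" and ?B = "S \<inter> SW r s"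
  let ?g = "\<lambda>(\<alpha>, \<beta>). S \<inter> NW r s \<union> \<alpha> \<union> \<beta>"
  have disj: "NW r s \<inter> NE r s = {}" "NW r s \<inter> SW r s = {}" "NE r s \<inter> SW r s = {}"
    "SE r s \<inter> NE r s = {}" "SE r s \<inter> SW r s = {}" "SE r s \<inter> NW r s = {}"
    and all: "NW r s \<union> NE r s \<union> SW r s \<union> SE r s = UNIV"
    by (auto simp: quadrant_defs)
  have "(\<Sum>\<mu>\<in>ideals_through S r s. \<Prod>c\<in>S - \<mu>. w c)
      = (\<Sum>p\<in>ideals ?A \<times> ideals ?B. \<Prod>c\<in>S - ?g p. w c)"
  proof (rule sum.reindex_bij_witness
      [where i = ?g and j = "\<lambda>\<mu>. (\<mu> \<inter> NE r s, \<mu> \<inter> SW r s)"])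
    fix \<mu> assume "\<mu> \<in> ideals_through S r s"
    then have \<mu>: "\<mu> \<in> ideals S" "S \<inter> NW r s \<subseteq> \<mu>" "\<mu> \<inter> SE r s = {}"
      by (auto simp: ideals_through_def)
    have eq: "S \<inter> NW r s \<union> (\<mu> \<inter> NE r s) \<union> (\<mu> \<inter> SW r s) = \<mu>"
      using \<mu> all ideals_subset[OF \<mu>(1)] by blast
    then show "?g (\<mu> \<inter> NE r s, \<mu> \<inter> SW r s) = \<mu>" by simp
    show "(\<mu> \<inter> NE r s, \<mu> \<inter> SW r s) \<in> ideals ?A \<times> ideals ?B"
      using ideals_Int[OF \<mu>(1)] by blast
    show "(\<Prod>c\<in>S - ?g (\<mu> \<inter> NE r s, \<mu> \<inter> SW r s). w c) = (\<Prod>c\<in>S - \<mu>. w c)"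
      using eq by simp
  next
    fix p assume p: "p \<in> ideals ?A \<times> ideals ?B"
    then obtain \<alpha> \<beta> where \<alpha>\<beta>: "p = (\<alpha>, \<beta>)" "\<alpha> \<in> ideals ?A" "\<beta> \<in> ideals ?B" by blast
    then show "?g p \<in> ideals_through S r s" using ideals_through_Un by simp
    have "\<alpha> \<subseteq> ?A" "\<beta> \<subseteq> ?B" using \<alpha>\<beta> ideals_subset by blast+
    then show "(?g p \<inter> NE r s, ?g p \<inter> SW r s) = p"
      using disj unfolding \<alpha>\<beta>(1) by auto
  qed
  also have "\<dots> = (\<Sum>p\<in>ideals ?A \<times> ideals ?B.
      (\<Prod>c\<in>?A - fst p. w c) * (\<Prod>c\<in>?B - snd p. w c) * (\<Prod>c\<in>S \<inter> SE r s. w c))"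
  proof (rule sum.cong[OF refl])
    fix p assume "p \<in> ideals ?A \<times> ideals ?B"
    then obtain \<alpha> \<beta> where p: "p = (\<alpha>, \<beta>)" and \<alpha>\<beta>: "\<alpha> \<subseteq> ?A" "\<beta> \<subseteq> ?B"
      using ideals_subset by blast
    \<comment> \<open>The north-west part of \<open>S\<close> is swallowed by the ideal, while the
      south-east part survives whole in the complement.\<close>
    have split: "S - ?g p = (?A - \<alpha>) \<union> (?B - \<beta>) \<union> (S \<inter> SE r s)"
      unfolding p using \<alpha>\<beta> disj all by auto
    show "(\<Prod>c\<in>S - ?g p. w c)
        = (\<Prod>c\<in>?A - fst p. w c) * (\<Prod>c\<in>?B - snd p. w c) * (\<Prod>c\<in>S \<inter> SE r s. w c)"
      unfolding split using fin disj
      by (subst prod.union_disjoint, simp, simp, blast,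
          subst prod.union_disjoint, simp, simp, blast, simp add: p)
  qed
  also have "\<dots> = ideal_sum w ?A * (\<Prod>c\<in>S \<inter> SE r s. w c) * ideal_sum w ?B"
    by (simp add: ideal_sum_def sum_product sum.cartesian_product case_prod_unfold
        sum_distrib_left sum_distrib_right mult_ac)
  finally show ?thesis .
qed


section \<open>Sorting ideals by their crossing with a diagonal, and the resulting triangular
  factors\<close>

section \<open>Factorization of the matrix\<close>

text \<open>The crossing is at the first diagonal box missing from \<mu>. If there were two, at k <
  l, the k-th diagonal box would be in \<mu>, lying north-west of the second, and outside \<mu>,
  lying in the south-east quadrant of the first.\<close>

lemma ideal_unique_crossing:
  assumes \<mu>: "\<mu> \<in> ideals S" and i: "i < n" and j: "j < n"
    and S: "S \<subseteq> SE (a + i) (b + j)"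
    and closed: "\<And>r s r' s'. (r, s) \<in> S \<Longrightarrow> a + i \<le> r' \<Longrightarrow> r' \<le> r \<Longrightarrow> b + j \<le> s' \<Longrightarrow> s' \<le> s
      \<Longrightarrow> (r', s') \<in> S"
    and diag: "\<And>k. max i j \<le> k \<Longrightarrow> k < n \<Longrightarrow> (a + k, b + k) \<in> S \<longleftrightarrow> k < n - 1"
  shows "\<exists>!k. k \<in> {max i j..<n} \<and> \<mu> \<in> ideals_through S (a + k) (b + k)"
proof (rule ex_ex1I)
  let ?P = "\<lambda>k. max i j \<le> k \<and> (a + k, b + k) \<notin> \<mu>"
  have "max i j \<le> n - 1" "n - 1 < n" using i j by auto
  \<comment> \<open>The diagonal box with index \<open>n - 1\<close> is already outside
    \<open>S\<close>; this makes the search succeed below \<open>n\<close>.\<close>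
  then have "?P (n - 1)" using diag[of "n - 1"] ideals_subset[OF \<mu>] by blast
  then have P: "?P (Least ?P)" and le: "Least ?P \<le> n - 1"
    by (rule LeastI, rule Least_le)
  define k where "k = Least ?P"
  have k: "max i j \<le> k" "k < n" "(a + k, b + k) \<notin> \<mu>" using P le i by (auto simp: k_def)
  have "\<mu> \<inter> SE (a + k) (b + k) = {}"
  proof -
    have False if "(r, s) \<in> \<mu>" "a + k \<le> r" "b + k \<le> s" for r s
    proof -
      have "(a + k, b + k) \<in> S"
        using closed[of r s "a + k" "b + k"] that k ideals_subset[OF \<mu>] by auto
      from idealsD[OF \<mu> that(1) this] that k show False by simp
    qed
    then show ?thesis by (auto simp: SE_def)
  qed
  moreover have "S \<inter> NW (a + k) (b + k) \<subseteq> \<mu>"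
  proof (cases "k = max i j")
    \<comment> \<open>Here k is i or j, and \<open>S\<close> has no box in rows above a + i and none
      in columns left of b + j, so the intersection is empty.\<close>
    case True
    then show ?thesis using S by (auto simp: quadrant_defs max_def split: if_splits)
  next
    case False
    \<comment> \<open>By minimality the preceding diagonal box is in \<mu>, and every box of
      \<open>NW (a + k) (b + k)\<close> is weakly north-west of it.\<close>
    then have "k - 1 < k" "max i j \<le> k - 1" using k by auto
    with not_less_Least[of "k - 1" ?P] have in\<mu>: "(a + (k - 1), b + (k - 1)) \<in> \<mu>"
      by (auto simp: k_def)
    show ?thesis
    proof
      fix c assume "c \<in> S \<inter> NW (a + k) (b + k)"
      then show "c \<in> \<mu>" using idealsD[OF \<mu> in\<mu>, of "fst c" "snd c"] by (auto simp: NW_def)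
    qed
  qed
  ultimately show "\<exists>k. k \<in> {max i j..<n} \<and> \<mu> \<in> ideals_through S (a + k) (b + k)"
    using k \<mu> by (intro exI[of _ k]) (auto simp: ideals_through_def)
next
  have less: False if "max i j \<le> k" "k < l" "l < n"
    "\<mu> \<in> ideals_through S (a + k) (b + k)" "\<mu> \<in> ideals_through S (a + l) (b + l)" for k l
  proof -
    have "(a + k, b + k) \<in> S \<inter> NW (a + l) (b + l)" using diag[of k] that by (auto simp: NW_def)
    moreover have "(a + k, b + k) \<in> SE (a + k) (b + k)" by (simp add: SE_def)
    ultimately show False using that(4,5) by (auto simp: ideals_through_def)
  qed
  fix k l
  assume "k \<in> {max i j..<n} \<and> \<mu> \<in> ideals_through S (a + k) (b + k)"
    "l \<in> {max i j..<n} \<and> \<mu> \<in> ideals_through S (a + l) (b + l)"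
  then show "k = l" using less[of k l] less[of l k] by (cases k l rule: linorder_cases) auto
qed

text \<open>Each ideal is counted once, at its crossing, where \<open>sum_ideals_through\<close>
  splits its contribution into three factors.\<close>

lemma ideal_sum_diagonal:
  fixes w :: "box \<Rightarrow> 'a::comm_ring_1"
  assumes fin: "finite S" and i: "i < n" and j: "j < n"
    and S: "S \<subseteq> SE (a + i) (b + j)"
    and closed: "\<And>r s r' s'. (r, s) \<in> S \<Longrightarrow> a + i \<le> r' \<Longrightarrow> r' \<le> r \<Longrightarrow> b + j \<le> s' \<Longrightarrow> s' \<le> s
      \<Longrightarrow> (r', s') \<in> S"
    and diag: "\<And>k. max i j \<le> k \<Longrightarrow> k < n \<Longrightarrow> (a + k, b + k) \<in> S \<longleftrightarrow> k < n - 1"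
  shows "ideal_sum w S = (\<Sum>k\<in>{max i j..<n}. ideal_sum w (S \<inter> NE (a + k) (b + k))
    * (\<Prod>c\<in>S \<inter> SE (a + k) (b + k). w c) * ideal_sum w (S \<inter> SW (a + k) (b + k)))"
proof -
  let ?T = "\<lambda>k. ideals_through S (a + k) (b + k)"
  have ex1: "\<exists>!k. k \<in> {max i j..<n} \<and> \<mu> \<in> ?T k" if "\<mu> \<in> ideals S" for \<mu>
    using ideal_unique_crossing[OF that i j S closed diag] .
  have "ideals S = (\<Union>k\<in>{max i j..<n}. ?T k)"
  proof
    show "ideals S \<subseteq> (\<Union>k\<in>{max i j..<n}. ?T k)" using ex1 by blast
    show "(\<Union>k\<in>{max i j..<n}. ?T k) \<subseteq> ideals S" by (auto simp: ideals_through_def)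
  qed
  then have "ideal_sum w S = (\<Sum>\<mu>\<in>(\<Union>k\<in>{max i j..<n}. ?T k). \<Prod>c\<in>S - \<mu>. w c)"
    by (simp only: ideal_sum_def)
  also have "\<dots> = (\<Sum>k\<in>{max i j..<n}. \<Sum>\<mu>\<in>?T k. \<Prod>c\<in>S - \<mu>. w c)"
  proof (rule sum.UNION_disjoint)
    show "\<forall>k\<in>{max i j..<n}. finite (?T k)"
      using finite_ideals[OF fin] by (auto simp: ideals_through_def)
    show "\<forall>k\<in>{max i j..<n}. \<forall>l\<in>{max i j..<n}. k \<noteq> l \<longrightarrow> ?T k \<inter> ?T l = {}"
    proof (intro ballI impI)
      fix k l assume kl: "k \<in> {max i j..<n}" "l \<in> {max i j..<n}" "k \<noteq> l"
      have False if "\<mu> \<in> ?T k" "\<mu> \<in> ?T l" for \<mu>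
      proof -
        have "\<mu> \<in> ideals S" using that by (simp add: ideals_through_def)
        from ex1[OF this] that kl show False by blast
      qed
      then show "?T k \<inter> ?T l = {}" by blast
    qed
  qed simp
  finally show ?thesis by (simp only: sum_ideals_through[OF fin])
qed

text \<open>The range k \<ge> max i j is exactly where an upper triangular entry (i, k) and a lower
  triangular entry (k, j) are both allowed, so the sum is a matrix product. The diagonal factor is
  absorbed into the upper matrix.\<close>

lemma det_LDU:
  fixes M U L :: "nat \<Rightarrow> nat \<Rightarrow> 'a::comm_ring_1" and d :: "nat \<Rightarrow> 'a"
  assumes M: "\<And>i j. i < n \<Longrightarrow> j < n \<Longrightarrow> M i j = (\<Sum>k\<in>{max i j..<n}. U i k * d k * L k j)"
    and U: "\<And>k. k < n \<Longrightarrow> U k k = 1" and L: "\<And>k. k < n \<Longrightarrow> L k k = 1"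
  shows "det (mat n n (\<lambda>(i, j). M i j)) = (\<Prod>k<n. d k)"
proof -
  define A where "A = mat n n (\<lambda>(i, k). if i \<le> k then U i k * d k else 0)"
  define B where "B = mat n n (\<lambda>(k, j). if j \<le> k then L k j else 0)"
  have carrier: "A \<in> carrier_mat n n" "B \<in> carrier_mat n n" by (auto simp: A_def B_def)
  have "mat n n (\<lambda>(i, j). M i j) = A * B"
  proof (rule eq_matI)
    fix i j assume "i < dim_row (A * B)" "j < dim_col (A * B)"
    then have ij: "i < n" "j < n" using carrier by auto
    have "(A * B) $$ (i, j) = (\<Sum>k\<in>{0..<n}. A $$ (i, k) * B $$ (k, j))"
      using ij carrier by (simp add: scalar_prod_def)
    also have "\<dots> = (\<Sum>k\<in>{max i j..<n}. A $$ (i, k) * B $$ (k, j))"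
      using ij by (intro sum.mono_neutral_right) (auto simp: A_def B_def)
    also have "\<dots> = M i j"
      unfolding M[OF ij] using ij by (intro sum.cong) (auto simp: A_def B_def)
    finally show "mat n n (\<lambda>(i, j). M i j) $$ (i, j) = (A * B) $$ (i, j)" using ij by simp
  qed (use carrier in auto)
  moreover have "det A = (\<Prod>k<n. d k)"
  proof -
    have "det A = prod_list (diag_mat A)"
      by (rule det_upper_triangular[OF _ carrier(1)]) (auto simp: A_def)
    then show ?thesis
      using U by (simp add: prod_list_diag_prod atLeast0LessThan A_def)
  qed
  moreover have "det B = 1"
  proof -
    have "det B = prod_list (diag_mat B)"
      by (rule det_lower_triangular[OF _ carrier(2)]) (auto simp: B_def)
    then show ?thesis using L by (simp add: prod_list_diag_prod B_def)
  qed
  ultimately show ?thesis using det_mult[OF carrier] by simp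
qed


section \<open>Diagram geometry and the evaluation of the determinants\<close>

section \<open>The determinants of the Bessenrodt--Stanley polynomials\<close>

text \<open>Removing the first row and column of the extended diagram leaves the original one,
  shifted diagonally. Closure properties and square sizes are transferred this way.\<close>

lemma young_diagram_iff_ext:
  "1 \<le> i \<Longrightarrow> 1 \<le> j \<Longrightarrow> (i, j) \<in> young_diagram lam \<longleftrightarrow> (i + 1, j + 1) \<in> ext_diagram lam"
  by (cases i) (auto simp: young_diagram_def ext_partition_def)

lemma young_diagram_down:
  assumes "is_partition lam" "lam \<noteq> []" "(i, j) \<in> young_diagram lam"
    and "1 \<le> i'" "i' \<le> i" "1 \<le> j'" "j' \<le> j"
  shows "(i', j') \<in> young_diagram lam"
  using assms ext_diagram_down[OF assms(1,2), of "i + 1" "j + 1" "i' + 1" "j' + 1"]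
  by (simp add: young_diagram_iff_ext[of _ _ lam])

lemma se_part_eq: "se_part lam (a, b) = young_diagram lam \<inter> SE a b"
  by (auto simp: se_part_def SE_def)

lemma finite_se_part: "finite (se_part lam c)"
  by (cases c) (simp add: se_part_eq)

lemma se_part_empty:
  assumes "is_partition lam" "lam \<noteq> []" "1 \<le> a" "1 \<le> b" "(a, b) \<notin> young_diagram lam"
  shows "se_part lam (a, b) = {}"
  using young_diagram_down[OF assms(1,2)] assms(3-) by (fastforce simp: se_part_def)

text \<open>\<open>se_part\<close> contains the whole rectangle between \<open>(a, b)\<close> and
  any of its boxes, so absolute and relative closedness coincide.\<close>

lemma sub_diagrams_eq_ideals:
  assumes "is_partition lam" "lam \<noteq> []" "1 \<le> a" "1 \<le> b"
  shows "sub_diagrams lam (a, b) = ideals (se_part lam (a, b))"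
proof -
  have closed: "(r', s') \<in> se_part lam (a, b)"
    if "(r, s) \<in> se_part lam (a, b)" "a \<le> r'" "r' \<le> r" "b \<le> s'" "s' \<le> s" for r s r' s'
    using that assms young_diagram_down[OF assms(1,2), of r s r' s'] by (auto simp: se_part_def)
  show ?thesis
  proof (intro equalityI subsetI)
    fix \<mu> assume \<mu>: "\<mu> \<in> sub_diagrams lam (a, b)"
    show "\<mu> \<in> ideals (se_part lam (a, b))"
    proof (rule idealsI)
      fix r s r' s'
      assume *: "(r, s) \<in> \<mu>" "(r', s') \<in> se_part lam (a, b)" "r' \<le> r" "s' \<le> s"
      then have "a \<le> r'" "b \<le> s'" by (auto simp: se_part_def)
      with * \<mu> show "(r', s') \<in> \<mu>" unfolding sub_diagrams_def by blast
    qed (use \<mu> in \<open>auto simp: sub_diagrams_def\<close>)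
  next
    fix \<mu> assume \<mu>: "\<mu> \<in> ideals (se_part lam (a, b))"
    have "(r', s') \<in> \<mu>" if "(r, s) \<in> \<mu>" "a \<le> r'" "r' \<le> r" "b \<le> s'" "s' \<le> s" for r s r' s'
      using that closed[of r s r' s'] idealsD[OF \<mu>, of r s r' s'] ideals_subset[OF \<mu>] by blast
    then show "\<mu> \<in> sub_diagrams lam (a, b)"
      using ideals_subset[OF \<mu>] unfolding sub_diagrams_def by blast
  qed
qed

text \<open>Off the diagram \<open>se_part\<close> is empty and has just the empty ideal, of weight
  1; the case distinction of \<open>bs_poly\<close> disappears.\<close>

lemma bs_poly_eq_ideal_sum:
  assumes "is_partition lam" "lam \<noteq> []" "1 \<le> a" "1 \<le> b"
  shows "bs_poly lam (a, b) = ideal_sum mvar (se_part lam (a, b))"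
  using sub_diagrams_eq_ideals[OF assms] se_part_empty[OF assms]
  by (auto simp: bs_poly_def ideal_sum_def[of mvar "se_part lam (a, b)", symmetric])

text \<open>Off the diagram every inner product is empty, so the value 1 on the border strip fits
  the general formula.\<close>

lemma theta_value_eq_prod:
  assumes lam: "is_partition lam" "lam \<noteq> []" and pos: "1 \<le> a" "1 \<le> b"
  shows "theta_value lam (a, b)
    = (\<Prod>r<square_size lam (a, b). \<Prod>c\<in>se_part lam (a + r, b + r). mvar c)"
proof (cases "(a, b) \<in> young_diagram lam")
  case False
  then have "(a + r, b + r) \<notin> young_diagram lam" for r
    using young_diagram_down[OF lam, of "a + r" "b + r" a b] pos by auto
  then have "se_part lam (a + r, b + r) = {}" for r using pos by (intro se_part_empty[OF lam]) auto
  with False show ?thesis by (simp add: theta_value_def)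
qed (simp add: theta_value_def)

lemma theta_value_nonzero: "theta_value lam c \<noteq> 0"
  by (cases c) (auto simp: theta_value_def finite_se_part mvar_nonzero)

text \<open>By the diagonal shift, membership of the k-th box says that a square of side k + 2 fits
  into the extended diagram. So only the last diagonal box of the maximal square lies on the border
  strip.\<close>

lemma diagonal_mem_young_diagram:
  assumes lam: "is_partition lam" "lam \<noteq> []" and pos: "1 \<le> a" "1 \<le> b"
    and k: "k < square_size lam (a, b)"
  shows "(a + k, b + k) \<in> young_diagram lam \<longleftrightarrow> k < square_size lam (a, b) - 1"
proof
  let ?n = "square_size lam (a, b)"
  assume "k < ?n - 1"
  then have "(a + k + 1, b + k + 1) \<in> {a..<a + ?n} \<times> {b..<b + ?n}" by auto
  then have "(a + k + 1, b + k + 1) \<in> ext_diagram lam" using square_size_subset by blast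
  then show "(a + k, b + k) \<in> young_diagram lam" using pos by (simp add: young_diagram_iff_ext[of _ _ lam])
next
  let ?n = "square_size lam (a, b)"
  assume "(a + k, b + k) \<in> young_diagram lam"
  then have "(a + k + 1, b + k + 1) \<in> ext_diagram lam"
    using pos young_diagram_iff_ext[of "a + k" "b + k" lam] by simp
  then have "{a..<a + (k + 2)} \<times> {b..<b + (k + 2)} \<subseteq> ext_diagram lam"
    using pos by (auto intro: ext_diagram_down[OF lam])
  then have "k + 2 \<le> ?n" by (rule square_size_ge)
  then show "k < ?n - 1" by simp
qed

lemma det_bs_poly:
  assumes lam: "is_partition lam" "lam \<noteq> []" and pos: "1 \<le> a" "1 \<le> b"
  defines "n \<equiv> square_size lam (a, b)"
  shows "det (mat n n (\<lambda>(i, j). bs_poly lam (a + i, b + j) :: (box, 'k::idom) mpoly))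
    = theta_value lam (a, b)"
proof -
  let ?Y = "young_diagram lam"
  \<comment> \<open>For i = k the row range is empty, which gives the unit diagonal; the column
    range does the same in \<open>L\<close>.\<close>
  define U where "U i k = ideal_sum (mvar :: box \<Rightarrow> (box, 'k) mpoly)
    (?Y \<inter> ({a + i..<a + k} \<times> {b + k..}))" for i k
  define L where "L k j = ideal_sum (mvar :: box \<Rightarrow> (box, 'k) mpoly)
    (?Y \<inter> ({a + k..} \<times> {b + j..<b + k}))" for k j
  have "bs_poly lam (a + i, b + j)
      = (\<Sum>k\<in>{max i j..<n}. U i k * (\<Prod>c\<in>se_part lam (a + k, b + k). mvar c) * L k j)"
    if ij: "i < n" "j < n" for i j
  proof -
    let ?S = "?Y \<inter> SE (a + i) (b + j)"
    have "bs_poly lam (a + i, b + j) = ideal_sum (mvar :: box \<Rightarrow> (box, 'k) mpoly) ?S"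
      using bs_poly_eq_ideal_sum[OF lam, of "a + i" "b + j"] pos by (simp add: se_part_eq)
    also have "\<dots> = (\<Sum>k\<in>{max i j..<n}. ideal_sum mvar (?S \<inter> NE (a + k) (b + k))
        * (\<Prod>c\<in>?S \<inter> SE (a + k) (b + k). mvar c) * ideal_sum mvar (?S \<inter> SW (a + k) (b + k)))"
    proof (rule ideal_sum_diagonal[OF _ ij])
      fix r s r' s' assume "(r, s) \<in> ?S" "a + i \<le> r'" "r' \<le> r" "b + j \<le> s'" "s' \<le> s"
      then show "(r', s') \<in> ?S"
        using young_diagram_down[OF lam, of r s r' s'] pos by (auto simp: SE_def)
    next
      fix k assume "max i j \<le> k" "k < n"
      then show "(a + k, b + k) \<in> ?S \<longleftrightarrow> k < n - 1"
        using diagonal_mem_young_diagram[OF lam pos, of k] by (auto simp: n_def SE_def)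
    qed auto
    also have "\<dots> = (\<Sum>k\<in>{max i j..<n}. U i k * (\<Prod>c\<in>se_part lam (a + k, b + k). mvar c) * L k j)"
    proof (rule sum.cong[OF refl])
      fix k assume "k \<in> {max i j..<n}"
      \<comment> \<open>Since k \<ge> max i j, the north-east piece no longer depends on j, the
        south-west piece no longer on i, and the south-east piece on neither. This is what permits a
        matrix factorization.\<close>
      then have "SE (a + i) (b + j) \<inter> NE (a + k) (b + k) = {a + i..<a + k} \<times> {b + k..}"
        "SE (a + i) (b + j) \<inter> SW (a + k) (b + k) = {a + k..} \<times> {b + j..<b + k}"
        "SE (a + i) (b + j) \<inter> SE (a + k) (b + k) = SE (a + k) (b + k)"
        by (auto simp: quadrant_defs)
      then show "ideal_sum mvar (?S \<inter> NE (a + k) (b + k))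
        * (\<Prod>c\<in>?S \<inter> SE (a + k) (b + k). mvar c) * ideal_sum mvar (?S \<inter> SW (a + k) (b + k))
        = U i k * (\<Prod>c\<in>se_part lam (a + k, b + k). mvar c) * L k j"
        by (simp add: U_def L_def se_part_eq Int_assoc)
    qed
    finally show ?thesis .
  qed
  then have "det (mat n n (\<lambda>(i, j). bs_poly lam (a + i, b + j) :: (box, 'k) mpoly))
      = (\<Prod>k<n. \<Prod>c\<in>se_part lam (a + k, b + k). mvar c)"
    by (rule det_LDU) (auto simp: U_def L_def)
  then show ?thesis by (simp add: theta_value_eq_prod[OF lam pos] n_def)
qed


section \<open>Arithmetic of specialization to polynomial values, and descent along the
  diagram\<close>

section \<open>Specialization\<close>

lemma mpoly_subst_uminus: "mpoly_subst \<sigma> (- f) = - mpoly_subst \<sigma> f"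
proof -
  have "mpoly_subst \<sigma> (- f) + mpoly_subst \<sigma> f = 0"
    using mpoly_subst_add[of \<sigma> "- f" f] by simp
  then show ?thesis by (simp add: eq_neg_iff_add_eq_0)
qed

text \<open>Clearing denominators replaces an equality of fractions by one of polynomials, which
  suits the ring operations below.\<close>

lemma specializes_to_poly_iff:
  "specializes_to \<sigma> f (Fract g 1) \<longleftrightarrow> (\<exists>P Q. f = Fract P Q \<and> mpoly_subst \<sigma> Q \<noteq> 0 \<and>
     mpoly_subst \<sigma> P = g * mpoly_subst \<sigma> Q)"
proof -
  have "Fract g 1 = Fract (mpoly_subst \<sigma> P) (mpoly_subst \<sigma> Q)
      \<longleftrightarrow> mpoly_subst \<sigma> P = g * mpoly_subst \<sigma> Q" if "mpoly_subst \<sigma> Q \<noteq> 0" for P Q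
    using that by (auto simp: eq_fract)
  then show ?thesis unfolding specializes_to_def by blast
qed

lemma specializes_to_polyE:
  assumes "specializes_to \<sigma> f (Fract g 1)"
  obtains P Q where "f = Fract P Q" "Q \<noteq> 0" "mpoly_subst \<sigma> Q \<noteq> 0"
    "mpoly_subst \<sigma> P = g * mpoly_subst \<sigma> Q"
  using assms unfolding specializes_to_poly_iff by (metis mpoly_subst_zero)

lemma specializes_to_of_poly: "specializes_to \<sigma> (Fract P 1) (Fract (mpoly_subst \<sigma> P) 1)"
  unfolding specializes_to_poly_iff by (intro exI[of _ P] exI[of _ 1]) simp

lemma specializes_to_zero: "specializes_to \<sigma> 0 (Fract 0 1)"
  using specializes_to_of_poly[of \<sigma> 0] by (simp add: Zero_fract_def)

lemma specializes_to_one: "specializes_to \<sigma> 1 (Fract 1 1)"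
  using specializes_to_of_poly[of \<sigma> 1] by (simp add: One_fract_def)

lemma specializes_to_add:
  assumes "specializes_to \<sigma> f (Fract f' 1)" "specializes_to \<sigma> g (Fract g' 1)"
  shows "specializes_to \<sigma> (f + g) (Fract (f' + g') 1)"
proof -
  from assms(1) obtain P Q where 1: "f = Fract P Q" "Q \<noteq> 0" "mpoly_subst \<sigma> Q \<noteq> 0"
    "mpoly_subst \<sigma> P = f' * mpoly_subst \<sigma> Q" by (rule specializes_to_polyE)
  from assms(2) obtain R S where 2: "g = Fract R S" "S \<noteq> 0" "mpoly_subst \<sigma> S \<noteq> 0"
    "mpoly_subst \<sigma> R = g' * mpoly_subst \<sigma> S" by (rule specializes_to_polyE)
  show ?thesis unfolding specializes_to_poly_iff
    by (intro exI[of _ "P * S + R * Q"] exI[of _ "Q * S"])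
      (use 1 2 in \<open>simp add: mpoly_subst_mult mpoly_subst_add algebra_simps\<close>)
qed

lemma specializes_to_mult:
  assumes "specializes_to \<sigma> f (Fract f' 1)" "specializes_to \<sigma> g (Fract g' 1)"
  shows "specializes_to \<sigma> (f * g) (Fract (f' * g') 1)"
proof -
  from assms(1) obtain P Q where 1: "f = Fract P Q" "Q \<noteq> 0" "mpoly_subst \<sigma> Q \<noteq> 0"
    "mpoly_subst \<sigma> P = f' * mpoly_subst \<sigma> Q" by (rule specializes_to_polyE)
  from assms(2) obtain R S where 2: "g = Fract R S" "S \<noteq> 0" "mpoly_subst \<sigma> S \<noteq> 0"
    "mpoly_subst \<sigma> R = g' * mpoly_subst \<sigma> S" by (rule specializes_to_polyE)
  show ?thesis unfolding specializes_to_poly_iff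
    by (intro exI[of _ "P * R"] exI[of _ "Q * S"])
      (use 1 2 in \<open>simp add: mpoly_subst_mult algebra_simps\<close>)
qed

lemma specializes_to_uminus:
  assumes "specializes_to \<sigma> f (Fract f' 1)"
  shows "specializes_to \<sigma> (- f) (Fract (- f') 1)"
proof -
  from assms obtain P Q where "f = Fract P Q" "mpoly_subst \<sigma> Q \<noteq> 0"
    "mpoly_subst \<sigma> P = f' * mpoly_subst \<sigma> Q" by (rule specializes_to_polyE)
  then show ?thesis unfolding specializes_to_poly_iff
    by (intro exI[of _ "- P"] exI[of _ Q]) (simp add: mpoly_subst_uminus)
qed

text \<open>The numerator R of d becomes the denominator of the quotient. It specializes to d' times
  a nonzero polynomial, hence not to 0, because d' \<noteq> 0.\<close>

lemma specializes_to_cancel: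
  assumes "specializes_to \<sigma> (f * d) (Fract (f' * d') 1)" "specializes_to \<sigma> d (Fract d' 1)"
    and "d' \<noteq> 0"
  shows "specializes_to \<sigma> f (Fract f' 1)"
proof -
  from assms(1) obtain P Q where 1: "f * d = Fract P Q" "Q \<noteq> 0" "mpoly_subst \<sigma> Q \<noteq> 0"
    "mpoly_subst \<sigma> P = f' * d' * mpoly_subst \<sigma> Q" by (rule specializes_to_polyE)
  from assms(2) obtain R S where 2: "d = Fract R S" "S \<noteq> 0" "mpoly_subst \<sigma> S \<noteq> 0"
    "mpoly_subst \<sigma> R = d' * mpoly_subst \<sigma> S" by (rule specializes_to_polyE)
  have R': "mpoly_subst \<sigma> R \<noteq> 0" using 2 assms(3) by simp
  then have "R \<noteq> 0" by auto
  then have "d \<noteq> 0" using 2 by (simp add: Zero_fract_def eq_fract)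
  then have "f = (f * d) / d" by simp
  also have "\<dots> = Fract P Q / Fract R S" by (rule arg_cong2[OF 1(1) 2(1)])
  also have "\<dots> = Fract (P * S) (Q * R)" by simp
  finally show ?thesis unfolding specializes_to_poly_iff
    by (intro exI[of _ "P * S"] exI[of _ "Q * R"])
      (use 1 2 R' in \<open>simp add: mpoly_subst_mult algebra_simps\<close>)
qed

lemma specializes_to_sum:
  assumes "\<And>i. i \<in> I \<Longrightarrow> specializes_to \<sigma> (f i) (Fract (f' i) 1)"
  shows "specializes_to \<sigma> (\<Sum>i\<in>I. f i) (Fract (\<Sum>i\<in>I. f' i) 1)"
  using assms
  by (induction I rule: infinite_finite_induct)
    (auto intro: specializes_to_zero specializes_to_add)

lemma specializes_to_prod:
  assumes "\<And>i. i \<in> I \<Longrightarrow> specializes_to \<sigma> (f i) (Fract (f' i) 1)"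
  shows "specializes_to \<sigma> (\<Prod>i\<in>I. f i) (Fract (\<Prod>i\<in>I. f' i) 1)"
  using assms
  by (induction I rule: infinite_finite_induct)
    (auto intro: specializes_to_one specializes_to_mult)

lemma specializes_to_signof: "specializes_to \<sigma> (signof \<pi>) (Fract (signof \<pi>) 1)"
  using specializes_to_one specializes_to_uminus[OF specializes_to_one]
  by (cases \<pi> rule: sign_cases) auto

text \<open>The Leibniz formula uses ring operations only.\<close>

lemma specializes_to_det:
  assumes A: "A \<in> carrier_mat n n" and B: "B \<in> carrier_mat n n"
    and AB: "\<And>i j. i < n \<Longrightarrow> j < n \<Longrightarrow> specializes_to \<sigma> (A $$ (i, j)) (Fract (B $$ (i, j)) 1)"
  shows "specializes_to \<sigma> (det A) (Fract (det B) 1)"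
  unfolding det_def'[OF A] det_def'[OF B]
  by (intro specializes_to_sum specializes_to_mult specializes_to_signof specializes_to_prod AB)
    (auto dest: permutes_in_image)

text \<open>Cofactors along the first row do not see that row; in particular the unknown corner
  entry may be left out of the hypothesis.\<close>

lemma specializes_to_cofactor:
  assumes A: "A \<in> carrier_mat (Suc n) (Suc n)" and B: "B \<in> carrier_mat (Suc n) (Suc n)"
    and AB: "\<And>i j. i \<le> n \<Longrightarrow> j \<le> n \<Longrightarrow> i \<noteq> 0 \<Longrightarrow>
      specializes_to \<sigma> (A $$ (i, j)) (Fract (B $$ (i, j)) 1)"
  shows "specializes_to \<sigma> (cofactor A 0 k) (Fract (cofactor B 0 k) 1)"
proof -
  have "specializes_to \<sigma> (det (mat_delete A 0 k)) (Fract (det (mat_delete B 0 k)) 1)"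
    by (rule specializes_to_det[of _ n]) (use A B in \<open>auto simp: mat_delete_def intro!: AB\<close>)
  moreover have "specializes_to \<sigma> ((- 1) ^ k) (Fract ((- 1) ^ k) 1)"
    using specializes_to_prod[of "{..<k}" \<sigma> "\<lambda>_. - 1" "\<lambda>_. - 1",
        OF specializes_to_uminus[OF specializes_to_one]] by simp
  ultimately show ?thesis by (simp add: cofactor_def specializes_to_mult)
qed

lemma specializes_to_corner:
  assumes A: "A \<in> carrier_mat (Suc n) (Suc n)" and B: "B \<in> carrier_mat (Suc n) (Suc n)"
    and AB: "\<And>i j. i \<le> n \<Longrightarrow> j \<le> n \<Longrightarrow> (i, j) \<noteq> (0, 0) \<Longrightarrow>
      specializes_to \<sigma> (A $$ (i, j)) (Fract (B $$ (i, j)) 1)"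
    and det: "specializes_to \<sigma> (det A) (Fract (det B) 1)"
    and nz: "cofactor B 0 0 \<noteq> 0"
  shows "specializes_to \<sigma> (A $$ (0, 0)) (Fract (B $$ (0, 0)) 1)"
proof -
  have cof: "specializes_to \<sigma> (cofactor A 0 k) (Fract (cofactor B 0 k) 1)" for k
    by (rule specializes_to_cofactor[OF A B]) (auto intro: AB)
  \<comment> \<open>Polymorphic in the entries: it serves \<open>A\<close> over the fraction field
    and \<open>B\<close> over the polynomials.\<close>
  have expand: "M $$ (0, 0) * cofactor M 0 0
      = det M + - (\<Sum>j\<in>{1..<Suc n}. M $$ (0, j) * cofactor M 0 j)"
    if "M \<in> carrier_mat (Suc n) (Suc n)" for M :: "'r::comm_ring_1 mat"
    using laplace_expansion_row[OF that, of 0]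
    by (simp add: lessThan_atLeast0 sum.atLeast_Suc_lessThan del: sum.op_ivl_Suc)
  have "specializes_to \<sigma> (A $$ (0, 0) * cofactor A 0 0) (Fract (B $$ (0, 0) * cofactor B 0 0) 1)"
    unfolding expand[OF A] expand[OF B]
    by (intro specializes_to_add det specializes_to_uminus specializes_to_sum
        specializes_to_mult AB cof) auto
  then show ?thesis using cof nz by (rule specializes_to_cancel)
qed

theorem theorem2p4:
  fixes lam :: "nat list" and a b :: nat
  assumes "is_partition lam" and "lam \<noteq> []"
    and "(a, b) \<in> ext_diagram lam"
  shows "specializes_to (theta_value lam)
           (theta_fun lam (a, b) :: (box, 'k::idom) mpoly fract)
           (Fract (bs_poly lam (a, b)) 1)"
proof -
  note lam = assms(1,2)
  let ?E = "ext_diagram lam"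
  have bound: "i + j \<le> Max ((\<lambda>(i, j). i + j) ` ?E)" if "(i, j) \<in> ?E" for i j
    using that by (intro Max_ge) force+
  from assms(3) show ?thesis
  proof (induction "Max ((\<lambda>(i, j). i + j) ` ?E) - (a + b)" arbitrary: a b rule: less_induct)
    case less
    note ab = \<open>(a, b) \<in> ?E\<close>
    then have pos: "1 \<le> a" "1 \<le> b" by (auto simp: young_diagram_def)
    obtain n where n: "square_size lam (a, b) = Suc n"
      "n = 0 \<or> (a + 1, b + 1) \<in> ?E \<and> square_size lam (a + 1, b + 1) = n"
      using square_size_Suc[OF lam ab] .
    define A where "A = mat (Suc n) (Suc n)
      (\<lambda>(i, j). theta_fun lam (a + i, b + j) :: (box, 'k) mpoly fract)"
    define B where "B = mat (Suc n) (Suc n)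
      (\<lambda>(i, j). bs_poly lam (a + i, b + j) :: (box, 'k) mpoly)"
    have carrier: "A \<in> carrier_mat (Suc n) (Suc n)" "B \<in> carrier_mat (Suc n) (Suc n)"
      by (auto simp: A_def B_def)
    have "specializes_to (theta_value lam) (A $$ (0, 0)) (Fract (B $$ (0, 0)) 1)"
    proof (rule specializes_to_corner[OF carrier])
      fix i j assume ij: "i \<le> n" "j \<le> n" "(i, j) \<noteq> (0, 0)"
      then have "(a + i, b + j) \<in> {a..<a + Suc n} \<times> {b..<b + Suc n}" by simp
      then have E: "(a + i, b + j) \<in> ?E" using square_size_subset[of a lam b] unfolding n(1) by blast
      \<comment> \<open>The bound on coordinate sums keeps the truncated subtraction from hiding the
        strict decrease.\<close>
      moreover have "Max ((\<lambda>(i, j). i + j) ` ?E) - (a + i + (b + j))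
          < Max ((\<lambda>(i, j). i + j) ` ?E) - (a + b)"
        using bound[OF E] ij by auto
      ultimately show "specializes_to (theta_value lam) (A $$ (i, j)) (Fract (B $$ (i, j)) 1)"
        using less.hyps[of "a + i" "b + j"] ij by (simp add: A_def B_def)
    next
      \<comment> \<open>The determinant of \<open>A\<close> is a single indeterminate, which the
        substitution sends to \<open>theta_value lam (a, b)\<close>, the determinant of
        \<open>B\<close>.\<close>
      have "det A = Fract (mvar (a, b)) 1"
        using theta_fun_det_identities[OF lam] ab n(1)
        by (auto simp: det_identities_def A_def)
      moreover have "det B = theta_value lam (a, b)"
        using det_bs_poly[OF lam pos] n(1) by (simp add: B_def)
      ultimately show "specializes_to (theta_value lam) (det A) (Fract (det B) 1)"
        using specializes_to_of_poly[of "theta_value lam" "mvar (a, b)"] by simp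
    next
      have "mat_delete B 0 0 = mat n n (\<lambda>(i, j). bs_poly lam (a + 1 + i, b + 1 + j))"
        by (rule eq_matI) (auto simp: mat_delete_def B_def)
      then have cof: "cofactor B 0 0 = det (mat n n (\<lambda>(i, j). bs_poly lam (a + 1 + i, b + 1 + j)))"
        by (simp add: cofactor_def)
      show "cofactor B 0 0 \<noteq> 0"
      proof (cases "n = 0")
        case False
        then show ?thesis
          using n(2) det_bs_poly[OF lam, of "a + 1" "b + 1", where ?'k = 'k]
          unfolding cof by (simp add: theta_value_nonzero)
      qed (simp add: cof)
    qed
    then show ?case by (simp add: A_def B_def)
  qed
qed

end
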